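(* Let $V$ and $W$ be binomial varieties of $\mathbb{P}^n$ that have the same binomial exponents. In addition, suppose that $V$ contains a point $p = [p_0:\cdots:p_n]$ with $p_0\cdots p_n \neq 0$, and $W$ also contains a point $q = [q_0:\cdots:q_n]$ with $q_0\cdots q_n \neq 0$. Let $HF_V, HF_W, HF_{V \star W}$ denote the Hilbert functions of $V$, $W$, $V \star W$ respectively. Then these Hilbert functions are all equal, i.e., $$HF_V(i) = HF_W(i) = HF_{V\star W}(i) \quad\text{for all } i \in \mathbb{N}.$$ In particular, $\deg(V) = \deg(W) = \deg(V\star W)$ and $\dim(V) = \dim(W) = \dim(V\star W)$.
   Context: $k$ is an algebraically closed field of characteristic zero, $\mathbb{P}^n$ is projective $n$-space over $k$, and $R = k[x_0,\ldots,x_n]$ has the standard grading. Projective varieties are Zariski closed subsets of $\mathbb{P}^n$ and need not be irreducible; $\mathbb{I}(X) \subseteq R$ denotes the homogeneous vanishing ideal of $X$. For $\alpha = (\alpha_0,\ldots,\alpha_n) \in \mathbb{N}^{n+1}$, $X^\alpha := x_0^{\alpha_0}\cdots x_n^{\alpha_n}$. The Hilbert function of a variety $V\subseteq\mathbb{P}^n$ is $HF_V(i) := \dim_k (R/\mathbb{I}(V))_i$, the $k$-dimension of the degree $i$ graded piece of $R/\mathbb{I}(V)$. Degree and dimension of $V$ are the usual ones, read off the Hilbert polynomial of $R/\mathbb{I}(V)$. Hadamard product: for points $p=[p_0:\cdots:p_n]$, $q=[q_0:\cdots:q_n]$, $p\star q := [p_0q_0:\cdots:p_nq_n]$, which is defined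 when $p_iq_i \neq 0$ for at least one $i$. For projective varieties $X,Y \subseteq \mathbb{P}^n$, $X \star Y$ is the Zariski closure of $\{p\star q \mid p \in X, q\in Y, p\star q \text{ is defined}\}$ in $\mathbb{P}^n$. A binomial is a polynomial with exactly two terms, $a_1X^{\alpha_1}-a_2X^{\alpha_2}$ with $a_1,a_2 \in k\setminus\{0\}$ and $\alpha_1\neq\alpha_2$; it is homogeneous if both monomials have the same degree. A projective variety $V \subseteq \mathbb{P}^n$ is a binomial variety if $\mathbb{I}(V)$ is generated by homogeneous binomials. Two binomial varieties $V$ and $W$ have the same binomial exponents if there are ordered lists $\alpha_1,\ldots,\alpha_s$ and $\beta_1,\ldots,\beta_s$ in $\mathbb{N}^{n+1}$, with $\alpha_i \neq \beta_i$ for all $i$ and the pairs $(\alpha_i,\beta_i)$ pairwise distinct, and nonzero constants $a_i,b_i,c_i,d_i \in k$ ($i=1,\ldots,s$) such that $\mathbb{I}(V) = \langle a_1X^{\alpha_1}-b_1X^{\beta_1},\ldots,a_sX^{\alpha_s}-b_sX^{\beta_s}\rangle$ and $\mathbb{I}(W) = \langle c_1X^{\alpha_1}-d_1X^{\beta_1},\ldots,c_sX^{\alpha_s}-d_sX^{\beta_s}\rangle$. *)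

theory Defs
  imports
    "HOL-Library.Poly_Mapping"
    "HOL-Computational_Algebra.Polynomial"
    "HOL-Analysis.Finite_Cartesian_Product"
    "HOL-Algebra.QuotRing"
    "HOL-Algebra.Embedded_Algebras"
begin

section \<open>The polynomial ring\<close>

text \<open>
  The homogeneous coordinates are indexed by a finite type \<open>'n\<close>, which plays the role of
  \<open>{0, \<dots>, n}\<close>: projective \<open>n\<close>-space corresponds to \<open>CARD('n) = n + 1\<close>.
  Exponent vectors are elements of \<open>'n \<Rightarrow>\<^sub>0 nat\<close>, and \<open>R\<close> is the monoid algebra of
  \<open>'n \<Rightarrow>\<^sub>0 nat\<close> over the coefficient field.
\<close>

type_synonym 'n expo = "'n \<Rightarrow>\<^sub>0 nat"
type_synonym ('n, 'k) mpoly = "('n \<Rightarrow>\<^sub>0 nat) \<Rightarrow>\<^sub>0 'k"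

abbreviation term_poly :: "'k \<Rightarrow> 'n expo \<Rightarrow> ('n, 'k::zero) mpoly"
  where "term_poly c \<alpha> \<equiv> Poly_Mapping.single \<alpha> c"

definition total_degree :: "'n::finite expo \<Rightarrow> nat"
  where "total_degree \<alpha> = (\<Sum>i\<in>UNIV. Poly_Mapping.lookup \<alpha> i)"

definition eval_poly :: "('n::finite, 'k::comm_ring_1) mpoly \<Rightarrow> 'k ^ 'n \<Rightarrow> 'k"
  where "eval_poly f x =
    (\<Sum>\<alpha>\<in>Poly_Mapping.keys f. Poly_Mapping.lookup f \<alpha> * (\<Prod>i\<in>UNIV. (x $ i) ^ Poly_Mapping.lookup \<alpha> i))"

definition graded_piece :: "nat \<Rightarrow> ('n::finite, 'k::comm_ring_1) mpoly set"
  where "graded_piece d = {f. \<forall>\<alpha>\<in>Poly_Mapping.keys f. total_degree \<alpha> = d}"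

definition poly_ring :: "('n, 'k::comm_ring_1) mpoly ring"
  where "poly_ring = \<lparr>carrier = UNIV, mult = (*), one = 1, zero = 0, add = (+)\<rparr>"

lemma cring_poly_ring: "cring (poly_ring :: ('n, 'k::comm_ring_1) mpoly ring)"
  by (rule cringI; (rule abelian_groupI comm_monoidI)?)
     (auto simp: poly_ring_def algebra_simps intro: exI[of _ "- _"] left_minus)


section \<open>Projective space and projective varieties\<close>

definition proj_rel :: "'k::field ^ 'n \<Rightarrow> 'k ^ 'n \<Rightarrow> bool"
  where "proj_rel x y \<longleftrightarrow> x \<noteq> 0 \<and> (\<exists>c. c \<noteq> 0 \<and> y = c *s x)"

lemma part_equivp_proj_rel: "part_equivp (proj_rel :: 'k::field ^ 'n::finite \<Rightarrow> _)"
proof (rule part_equivpI)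
  show "\<exists>x :: 'k ^ 'n. proj_rel x x"
    by (rule exI[of _ 1]) (auto simp: proj_rel_def vec_eq_iff intro: exI[of _ 1])
  show "symp (proj_rel :: 'k ^ 'n \<Rightarrow> _)"
  proof (rule sympI)
    fix x y :: "'k ^ 'n" assume "proj_rel x y"
    then obtain c where c: "x \<noteq> 0" "c \<noteq> 0" "y = c *s x" by (auto simp: proj_rel_def)
    then have "x = inverse c *s y" by (simp add: vec_eq_iff)
    with c show "proj_rel y x"
      unfolding proj_rel_def by (metis nonzero_imp_inverse_nonzero vector_mul_eq_0)
  qed
  show "transp (proj_rel :: 'k ^ 'n \<Rightarrow> _)"
  proof (rule transpI)
    fix x y z :: "'k ^ 'n" assume "proj_rel x y" "proj_rel y z"
    then obtain c d where "x \<noteq> 0" "c \<noteq> 0" "y = c *s x" "d \<noteq> 0" "z = d *s y"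
      by (auto simp: proj_rel_def)
    then show "proj_rel x z"
      unfolding proj_rel_def by (intro conjI exI[of _ "d * c"]) (auto simp: vector_smult_assoc)
  qed
qed

quotient_type (overloaded) ('k, 'n) proj = "'k::field ^ 'n::finite" / partial: proj_rel
  by (rule part_equivp_proj_rel)

lift_definition vanishes_at :: "('n::finite, 'k::field) mpoly \<Rightarrow> ('k, 'n) proj \<Rightarrow> bool"
  is "\<lambda>f x. \<forall>c. c \<noteq> 0 \<longrightarrow> eval_poly f (c *s x) = 0"
proof -
  fix f :: "('n, 'k) mpoly" and x y :: "'k ^ 'n"
  have *: "\<forall>c. c \<noteq> 0 \<longrightarrow> eval_poly f (c *s y) = 0"
    if "proj_rel x y" "\<forall>c. c \<noteq> 0 \<longrightarrow> eval_poly f (c *s x) = 0" for x y :: "'k ^ 'n"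
    using that by (auto simp: proj_rel_def vector_smult_assoc)
  assume "proj_rel x y"
  moreover from this have "proj_rel y x"
    using part_equivp_proj_rel part_equivp_symp by metis
  ultimately show "(\<forall>c. c \<noteq> 0 \<longrightarrow> eval_poly f (c *s x) = 0) =
      (\<forall>c. c \<noteq> 0 \<longrightarrow> eval_poly f (c *s y) = 0)"
    using * by blast
qed

definition projective_variety :: "('k::field, 'n::finite) proj set \<Rightarrow> bool"
  where "projective_variety X \<longleftrightarrow>
    (\<exists>S. S \<subseteq> (\<Union>d. graded_piece d) \<and> X = {p. \<forall>f\<in>S. vanishes_at f p})"

abbreviation zariski_closure :: "('k::field, 'n::finite) proj set \<Rightarrow> ('k, 'n) proj set"
  where "zariski_closure A \<equiv> projective_variety hull A"

definition vanishing_ideal :: "('k::field, 'n::finite) proj set \<Rightarrow> ('n, 'k) mpoly set"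
  where "vanishing_ideal X = {f. \<forall>p\<in>X. vanishes_at f p}"

lift_definition coords_prod_nonzero :: "('k::field, 'n::finite) proj \<Rightarrow> bool"
  is "\<lambda>x. (\<Prod>i\<in>UNIV. x $ i) \<noteq> 0"
  by (auto simp: proj_rel_def)


section \<open>Hadamard products\<close>

text \<open>Multiplication on \<open>'k ^ 'n\<close> is coordinatewise.\<close>

lift_definition hadamard_defined :: "('k::field, 'n::finite) proj \<Rightarrow> ('k, 'n) proj \<Rightarrow> bool"
  is "\<lambda>x y. \<exists>i. x $ i * y $ i \<noteq> 0"
  by (auto simp: proj_rel_def)

text \<open>If the product is not defined, the value is the irrelevant default \<open>[1 : \<dots> : 1]\<close>.\<close>

lift_definition hadamard_point :: "('k::field, 'n::finite) proj \<Rightarrow> ('k, 'n) proj \<Rightarrow> ('k, 'n) proj"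
  is "\<lambda>x y. if \<exists>i. x $ i * y $ i \<noteq> 0 then x * y else 1"
proof -
  fix x x' y y' :: "'k ^ 'n"
  assume "proj_rel x x'" "proj_rel y y'"
  then obtain c d where cd: "c \<noteq> 0" "x' = c *s x" "d \<noteq> 0" "y' = d *s y"
    by (auto simp: proj_rel_def)
  have 1: "proj_rel (1 :: 'k ^ 'n) 1"
    by (auto simp: proj_rel_def vec_eq_iff intro: exI[of _ 1])
  have 2: "proj_rel (x * y) (x' * y')" if "x $ i * y $ i \<noteq> 0" for i
    unfolding proj_rel_def using that cd
    by (intro conjI exI[of _ "c * d"]) (auto simp: vec_eq_iff)
  have "(\<exists>i. x' $ i * y' $ i \<noteq> 0) \<longleftrightarrow> (\<exists>i. x $ i * y $ i \<noteq> 0)"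
    using cd by simp
  then show "proj_rel (if \<exists>i. x $ i * y $ i \<noteq> 0 then x * y else 1)
      (if \<exists>i. x' $ i * y' $ i \<noteq> 0 then x' * y' else 1)"
    using 1 2 by auto
qed

definition hadamard_product ::
    "('k::field, 'n::finite) proj set \<Rightarrow> ('k, 'n) proj set \<Rightarrow> ('k, 'n) proj set"  (infixl \<open>\<star>\<close> 70)
  where "X \<star> Y =
    zariski_closure {hadamard_point p q | p q. p \<in> X \<and> q \<in> Y \<and> hadamard_defined p q}"


section \<open>Binomial varieties\<close>

definition homogeneous_binomials :: "('n::finite, 'k::field) mpoly set"
  where "homogeneous_binomials =
    {term_poly a \<alpha> - term_poly b \<beta> | a b \<alpha> \<beta>.
      a \<noteq> 0 \<and> b \<noteq> 0 \<and> \<alpha> \<noteq> \<beta> \<and> total_degree \<alpha> = total_degree \<beta>}"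

definition binomial_variety :: "('k::field, 'n::finite) proj set \<Rightarrow> bool"
  where "binomial_variety V \<longleftrightarrow> projective_variety V \<and>
    (\<exists>B. B \<subseteq> homogeneous_binomials \<and> vanishing_ideal V = Idl\<^bsub>poly_ring\<^esub> B)"

definition same_binomial_exponents ::
    "('k::field, 'n::finite) proj set \<Rightarrow> ('k, 'n) proj set \<Rightarrow> bool"
  where "same_binomial_exponents V W \<longleftrightarrow>
    (\<exists>(s::nat) (\<alpha> :: nat \<Rightarrow> 'n expo) (\<beta> :: nat \<Rightarrow> 'n expo)
        (a :: nat \<Rightarrow> 'k) (b :: nat \<Rightarrow> 'k) (c :: nat \<Rightarrow> 'k) (d :: nat \<Rightarrow> 'k).
      (\<forall>i<s. \<alpha> i \<noteq> \<beta> i) \<and> inj_on (\<lambda>i. (\<alpha> i, \<beta> i)) {..<s} \<and>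
      (\<forall>i<s. a i \<noteq> 0 \<and> b i \<noteq> 0 \<and> c i \<noteq> 0 \<and> d i \<noteq> 0) \<and>
      vanishing_ideal V =
        Idl\<^bsub>poly_ring\<^esub> ((\<lambda>i. term_poly (a i) (\<alpha> i) - term_poly (b i) (\<beta> i)) ` {..<s}) \<and>
      vanishing_ideal W =
        Idl\<^bsub>poly_ring\<^esub> ((\<lambda>i. term_poly (c i) (\<alpha> i) - term_poly (d i) (\<beta> i)) ` {..<s}))"


section \<open>Hilbert function, dimension and degree\<close>

definition coord_ring :: "('k::field, 'n::finite) proj set \<Rightarrow> ('n, 'k) mpoly set ring"
  where "coord_ring V = poly_ring Quot (vanishing_ideal V)"

definition coord_class :: "('k::field, 'n::finite) proj set \<Rightarrow> ('n, 'k) mpoly \<Rightarrow> ('n, 'k) mpoly set"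
  where "coord_class V f = vanishing_ideal V +>\<^bsub>poly_ring\<^esub> f"

text \<open>
  The field \<open>k\<close> sits inside \<open>R / \<I>(V)\<close> as the classes of the constant polynomials, and the
  degree \<open>i\<close> piece of \<open>R / \<I>(V)\<close> is the image of \<open>R\<^sub>i\<close>.
\<close>

definition hilbert_function :: "('k::field, 'n::finite) proj set \<Rightarrow> nat \<Rightarrow> nat"
  where "hilbert_function V i =
    ring.dim (coord_ring V)
      (coord_class V ` range (\<lambda>c. term_poly c 0)) (coord_class V ` graded_piece i)"

definition hilbert_polynomial :: "('k::field, 'n::finite) proj set \<Rightarrow> rat poly"
  where "hilbert_polynomial V =
    (THE P. \<forall>\<^sub>F i in sequentially. poly P (of_nat i) = of_nat (hilbert_function V i))"

text \<open>The zero Hilbert polynomial (empty variety) gives dimension \<open>-1\<close> and degree \<open>0\<close>.\<close>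

definition variety_dim :: "('k::field, 'n::finite) proj set \<Rightarrow> int"
  where "variety_dim V =
    (if hilbert_polynomial V = 0 then -1 else int (degree (hilbert_polynomial V)))"

definition variety_degree :: "('k::field, 'n::finite) proj set \<Rightarrow> rat"
  where "variety_degree V =
    fact (degree (hilbert_polynomial V)) * lead_coeff (hilbert_polynomial V)"

end

theory Submission
  imports Defs
begin

text \<open>
  The torus acts on projective space by coordinatewise multiplication, and each torus element
  induces a graded automorphism of the polynomial ring, so dilations preserve Hilbert functions.
  Let \<open>v\<close> be a representative of a point of \<open>W\<close> and \<open>y\<close> a representative of \<open>q\<close>. A generator
  \<open>c X\<^sup>\<alpha> - d X\<^sup>\<beta>\<close> of \<open>\<I>(W)\<close> vanishes at both, so \<open>X\<^sup>\<alpha>\<close> and \<open>X\<^sup>\<beta>\<close> agree at \<open>v / y\<close>;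
  multiplication by \<open>v / y\<close> therefore preserves the zero set of every binomial with these exponents,
  whatever its coefficients. Hence \<open>V = (p / q) W\<close>, and the products of points of \<open>V\<close> and \<open>W\<close> form
  \<open>q V\<close>, which is already closed.
\<close>

text \<open>Setting a coefficient at a fresh exponent adds a single term. Additive identities thus
  need checking on terms only, and multiplicative ones follow by nesting the induction over both
  factors.\<close>

lemma poly_mapping_single_add_induct [case_names single add]:
  assumes "\<And>\<alpha> c. P (Poly_Mapping.single \<alpha> c)"
    and "\<And>f g. P f \<Longrightarrow> P g \<Longrightarrow> P (f + g)"
  shows "P (f :: 'a \<Rightarrow>\<^sub>0 'b::monoid_add)"
proof (induction f rule: Poly_Mapping.update_induct)
  case const
  \<comment> \<open>The zero polynomial is a term with coefficient 0, at any exponent.\<close>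
  show ?case using assms(1)[of undefined 0] by simp
next
  case (update f \<alpha> c)
  have "Poly_Mapping.update \<alpha> c f = f + Poly_Mapping.single \<alpha> c"
    using update.hyps(1)
    by (intro poly_mapping_eqI)
      (auto simp: lookup_update lookup_add lookup_single in_keys_iff when_def)
  then show ?case using assms update.IH by simp
qed

section \<open>Evaluation of monomials and polynomials\<close>

definition monom_eval :: "'k::comm_ring_1 ^ 'n::finite \<Rightarrow> 'n expo \<Rightarrow> 'k"
  where "monom_eval x \<alpha> = (\<Prod>i\<in>UNIV. (x $ i) ^ Poly_Mapping.lookup \<alpha> i)"

lemma monom_eval_zero [simp]: "monom_eval x 0 = 1"
  by (simp add: monom_eval_def)

lemma monom_eval_add: "monom_eval x (\<alpha> + \<beta>) = monom_eval x \<alpha> * monom_eval x \<beta>"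
  by (simp add: monom_eval_def lookup_add power_add prod.distrib)

lemma monom_eval_mult: "monom_eval (x * y) \<alpha> = monom_eval x \<alpha> * monom_eval y \<alpha>"
  by (simp add: monom_eval_def power_mult_distrib prod.distrib)

lemma monom_eval_one [simp]: "monom_eval 1 \<alpha> = 1"
  by (simp add: monom_eval_def)

lemma monom_eval_nonzero:
  fixes x :: "'k::field ^ 'n::finite"
  shows "(\<And>i. x $ i \<noteq> 0) \<Longrightarrow> monom_eval x \<alpha> \<noteq> 0"
  by (simp add: monom_eval_def)

lemma eval_poly_alt:
  "eval_poly f x = (\<Sum>\<alpha>\<in>Poly_Mapping.keys f. Poly_Mapping.lookup f \<alpha> * monom_eval x \<alpha>)"
  by (simp add: eval_poly_def monom_eval_def)

lemma eval_poly_single [simp]: "eval_poly (term_poly c \<alpha>) x = c * monom_eval x \<alpha>"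
  by (simp add: eval_poly_alt)

lemma eval_poly_add [simp]: "eval_poly (f + g) x = eval_poly f x + eval_poly g x"
  unfolding eval_poly_alt
  by (rule setsum_keys_plus_distrib) (simp_all add: distrib_right)

lemma eval_poly_uminus [simp]: "eval_poly (- f) x = - eval_poly f x"
  by (simp add: eval_poly_alt sum_negf)

lemma eval_poly_diff [simp]: "eval_poly (f - g) x = eval_poly f x - eval_poly g x"
  using eval_poly_add[of f "- g" x] by simp

lemma eval_poly_zero [simp]: "eval_poly 0 x = 0"
  by (simp add: eval_poly_alt)

lemma eval_poly_mult [simp]: "eval_poly (f * g) x = eval_poly f x * eval_poly g x"
proof (induction f rule: poly_mapping_single_add_induct)
  case (single \<alpha> c)
  show ?case
    by (induction g rule: poly_mapping_single_add_induct)
      (simp_all add: mult_single monom_eval_add algebra_simps)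
qed (simp add: distrib_right)

section \<open>Dilation of polynomials\<close>

definition dilate_poly :: "'k::comm_ring_1 ^ 'n::finite \<Rightarrow> ('n, 'k) mpoly \<Rightarrow> ('n, 'k) mpoly"
  where "dilate_poly t = Poly_Mapping.mapp (\<lambda>\<alpha> c. monom_eval t \<alpha> * c)"

lemma lookup_dilate_poly:
  "Poly_Mapping.lookup (dilate_poly t f) \<alpha> = monom_eval t \<alpha> * Poly_Mapping.lookup f \<alpha>"
  by (simp add: dilate_poly_def lookup_mapp when_def in_keys_iff)

lemma dilate_poly_single [simp]:
  "dilate_poly t (term_poly c \<alpha>) = term_poly (monom_eval t \<alpha> * c) \<alpha>"
  by (rule poly_mapping_eqI) (simp add: lookup_dilate_poly lookup_single when_def)

lemma dilate_poly_add [simp]: "dilate_poly t (f + g) = dilate_poly t f + dilate_poly t g"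
  by (rule poly_mapping_eqI) (simp add: lookup_dilate_poly lookup_add distrib_left)

lemma dilate_poly_mult [simp]: "dilate_poly t (f * g) = dilate_poly t f * dilate_poly t g"
proof (induction f rule: poly_mapping_single_add_induct)
  case (single \<alpha> c)
  show ?case
    by (induction g rule: poly_mapping_single_add_induct)
      (simp_all add: mult_single monom_eval_add algebra_simps)
qed (simp add: distrib_right)

lemma dilate_poly_one [simp]: "dilate_poly t 1 = 1"
  by (metis dilate_poly_single monom_eval_zero mult_1 single_one)

lemma dilate_poly_dilate_poly: "dilate_poly s (dilate_poly t f) = dilate_poly (s * t) f"
  by (rule poly_mapping_eqI) (simp add: lookup_dilate_poly monom_eval_mult mult.assoc)

lemma dilate_poly_id [simp]: "dilate_poly 1 f = f"
  by (rule poly_mapping_eqI) (simp add: lookup_dilate_poly)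

text \<open>Dilation is thus the substitution of \<open>t $ i\<close> times the variable for each
  variable, written as a rescaling of coefficients. In that form no new exponent can appear, so
  degrees are kept, and the action law reduces to multiplicativity of
  \<open>monom_eval\<close>.\<close>

lemma eval_dilate_poly [simp]: "eval_poly (dilate_poly t f) x = eval_poly f (t * x)"
  by (induction f rule: poly_mapping_single_add_induct)
    (simp_all add: monom_eval_mult algebra_simps)

lemma dilate_poly_graded_piece:
  "f \<in> graded_piece d \<Longrightarrow> dilate_poly t f \<in> graded_piece d"
  by (auto simp: graded_piece_def in_keys_iff lookup_dilate_poly)

section \<open>The torus and its action on polynomials and points\<close>

definition torus :: "('k::field ^ 'n::finite) set"
  where "torus = {t. \<forall>i. t $ i \<noteq> 0}"

definition torus_inverse :: "'k::field ^ 'n::finite \<Rightarrow> 'k ^ 'n"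
  where "torus_inverse t = (\<chi> i. inverse (t $ i))"

lemma torus_inverse_in [simp]: "t \<in> torus \<Longrightarrow> torus_inverse t \<in> torus"
  by (simp add: torus_def torus_inverse_def)

lemma torus_mult [simp]: "s \<in> torus \<Longrightarrow> t \<in> torus \<Longrightarrow> s * t \<in> torus"
  by (simp add: torus_def)

lemma torus_inverse_left [simp]: "t \<in> torus \<Longrightarrow> torus_inverse t * t = 1"
  by (simp add: torus_def torus_inverse_def vec_eq_iff)

lemma torus_inverse_right [simp]: "t \<in> torus \<Longrightarrow> t * torus_inverse t = 1"
  by (simp add: torus_def torus_inverse_def vec_eq_iff)

lemma torus_mult_nonzero: "t \<in> torus \<Longrightarrow> x \<noteq> 0 \<Longrightarrow> t * x \<noteq> 0"
  by (auto simp: torus_def vec_eq_iff)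

lemma bij_dilate_poly: "t \<in> torus \<Longrightarrow> bij (dilate_poly t)"
  by (rule bij_betwI[of _ _ _ "dilate_poly (torus_inverse t)"])
    (simp_all add: dilate_poly_dilate_poly)

lemma dilate_poly_image_graded_piece:
  assumes "t \<in> torus"
  shows "dilate_poly t ` graded_piece d = graded_piece d"
proof
  show "dilate_poly t ` graded_piece d \<subseteq> graded_piece d"
    using dilate_poly_graded_piece by blast
  show "graded_piece d \<subseteq> dilate_poly t ` graded_piece d"
  proof
    fix f :: "('b, 'a) mpoly" assume "f \<in> graded_piece d"
    then have "dilate_poly (torus_inverse t) f \<in> graded_piece d"
      by (rule dilate_poly_graded_piece)
    moreover have "f = dilate_poly t (dilate_poly (torus_inverse t) f)"
      using assms by (simp add: dilate_poly_dilate_poly)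
    ultimately show "f \<in> dilate_poly t ` graded_piece d" by blast
  qed
qed

lemma dilate_poly_ring_iso: "t \<in> torus \<Longrightarrow> dilate_poly t \<in> ring_iso poly_ring poly_ring"
  by (simp add: ring_iso_def ring_hom_def poly_ring_def bij_dilate_poly)

text \<open>Outside the torus \<open>t * x\<close> could be the zero vector, which represents no
  point; the identity is the default there.\<close>

lift_definition dilate_proj ::
    "'k::field ^ 'n::finite \<Rightarrow> ('k, 'n) proj \<Rightarrow> ('k, 'n) proj"
  is "\<lambda>t x. if t \<in> torus then t * x else x"
  by (auto simp: proj_rel_def torus_mult_nonzero) (auto simp: vec_eq_iff)

lemma proj_cases:
  obtains x where "x \<noteq> 0" "P = abs_proj x"
proof -
  have "\<exists>x. proj_rel x x \<and> P = abs_proj x"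
    by (metis Quotient_abs_rep Quotient_proj Quotient_rep_reflp)
  then show thesis using that by (auto simp: proj_rel_def)
qed

lemma proj_rel_refl_iff [simp]: "proj_rel x x \<longleftrightarrow> x \<noteq> 0"
  by (auto simp: proj_rel_def intro: exI[of _ 1])

lemma vanishes_at_abs:
  "x \<noteq> 0 \<Longrightarrow> vanishes_at f (abs_proj x) \<longleftrightarrow> (\<forall>c. c \<noteq> 0 \<longrightarrow> eval_poly f (c *s x) = 0)"
  by (simp add: vanishes_at.abs_eq)

lemma dilate_proj_abs: "t \<in> torus \<Longrightarrow> x \<noteq> 0 \<Longrightarrow> dilate_proj t (abs_proj x) = abs_proj (t * x)"
  by (simp add: dilate_proj.abs_eq)

lemma vanishes_at_dilate_proj:
  assumes "t \<in> torus"
  shows "vanishes_at f (dilate_proj t P) \<longleftrightarrow> vanishes_at (dilate_poly t f) P"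
proof -
  obtain x where x: "x \<noteq> 0" "P = abs_proj x" by (rule proj_cases)
  \<comment> \<open>\<open>vanishes_at\<close> tests every nonzero multiple of a representative, so
    dilation has to commute with scaling.\<close>
  have "t * (c *s x) = c *s (t * x)" for c by (simp add: vec_eq_iff)
  with x assms show ?thesis
    by (simp add: dilate_proj_abs vanishes_at_abs torus_mult_nonzero)
qed

lemma dilate_proj_dilate_proj:
  assumes "s \<in> torus" "t \<in> torus"
  shows "dilate_proj s (dilate_proj t P) = dilate_proj (s * t) P"
proof -
  obtain x where "x \<noteq> 0" "P = abs_proj x" by (rule proj_cases)
  with assms show ?thesis by (simp add: dilate_proj_abs torus_mult_nonzero mult.assoc)
qed

lemma dilate_proj_one [simp]: "dilate_proj 1 P = P"
proof -
  obtain x where "x \<noteq> 0" "P = abs_proj x" by (rule proj_cases)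
  then show ?thesis by (simp add: dilate_proj_abs torus_def)
qed

text \<open>Pullback is contravariant: the ideal of the dilated set is the preimage of the ideal of
  X. Surjectivity turns this into an image, the shape needed for the induced map of quotient
  rings.\<close>

lemma vanishing_ideal_dilate:
  assumes "t \<in> torus"
  shows "dilate_poly t ` vanishing_ideal (dilate_proj t ` X) = vanishing_ideal X"
proof -
  have "vanishing_ideal (dilate_proj t ` X) = dilate_poly t -` vanishing_ideal X"
    using assms by (auto simp: vanishing_ideal_def vanishes_at_dilate_proj)
  then show ?thesis
    using bij_is_surj[OF bij_dilate_poly[OF assms]] by (simp add: surj_image_vimage_eq)
qed

text \<open>The dilated set is cut out by the equations of X pulled back along the inverse torus
  element, and these are still homogeneous.\<close>

lemma projective_variety_dilate:
  assumes t: "t \<in> torus" and "projective_variety X"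
  shows "projective_variety (dilate_proj t ` X)"
proof -
  obtain S where S: "S \<subseteq> (\<Union>d. graded_piece d)" "X = {P. \<forall>f\<in>S. vanishes_at f P}"
    using assms(2) unfolding projective_variety_def by blast
  have "dilate_poly (torus_inverse t) ` S \<subseteq> (\<Union>d. graded_piece d)"
    using S(1) dilate_poly_graded_piece by blast
  moreover have "P \<in> dilate_proj t ` X \<longleftrightarrow> dilate_proj (torus_inverse t) P \<in> X" for P
    using t by (auto simp: dilate_proj_dilate_proj image_iff
        intro!: bexI[of _ "dilate_proj (torus_inverse t) P"])
  then have "dilate_proj t ` X = {P. \<forall>f\<in>dilate_poly (torus_inverse t) ` S. vanishes_at f P}"
    using t by (auto simp: S(2) vanishes_at_dilate_proj)
  ultimately show ?thesis unfolding projective_variety_def by blast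
qed


section \<open>Vanishing ideals, and invariance of Hilbert functions under dilation\<close>

lemma carrier_poly_ring: "carrier poly_ring = UNIV"
  by (simp add: poly_ring_def)

lemma ideal_vanishing_ideal:
  fixes X :: "('k::field, 'n::finite) proj set"
  shows "ideal (vanishing_ideal X) poly_ring"
proof -
  interpret cring "poly_ring :: ('n, 'k) mpoly ring" by (rule cring_poly_ring)
  have inv: "\<ominus>\<^bsub>poly_ring\<^esub> f = - f" for f :: "('n, 'k) mpoly"
    by (rule minus_equality) (simp_all add: poly_ring_def)
  have *: "vanishes_at (0 :: ('n, 'k) mpoly) P"
    "vanishes_at f P \<Longrightarrow> vanishes_at g P \<Longrightarrow> vanishes_at (f + g) P"
    "vanishes_at f P \<Longrightarrow> vanishes_at (- f) P"
    "vanishes_at f P \<Longrightarrow> vanishes_at (f * g) P"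
    "vanishes_at f P \<Longrightarrow> vanishes_at (g * f) P" for f g :: "('n, 'k) mpoly" and P
    by (rule proj_cases[of P]; simp add: vanishes_at_abs)+
  have "subgroup (vanishing_ideal X) (add_monoid poly_ring)"
    by (rule group.subgroupI[OF a_group])
      (auto simp: vanishing_ideal_def * inv[unfolded a_inv_def poly_ring_def, simplified] poly_ring_def intro: exI[of _ 0])
  then show ?thesis
    by (rule idealI[OF ring_axioms]) (auto simp: vanishing_ideal_def * poly_ring_def)
qed

text \<open>The polynomials vanishing at the single point P form an ideal, so it contains the ideal
  generated by B as soon as it contains B.\<close>

lemma vanishes_at_genideal:
  fixes X :: "('k::field, 'n::finite) proj set"
  assumes "vanishing_ideal X = Idl\<^bsub>poly_ring\<^esub> B" "\<And>f. f \<in> B \<Longrightarrow> vanishes_at f P"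
    and "f \<in> vanishing_ideal X"
  shows "vanishes_at f P"
proof -
  interpret cring "poly_ring :: ('n, 'k) mpoly ring" by (rule cring_poly_ring)
  have "Idl\<^bsub>poly_ring\<^esub> B \<subseteq> vanishing_ideal {P}"
    by (rule genideal_minimal[OF ideal_vanishing_ideal]) (auto simp: vanishing_ideal_def assms(2))
  with assms(1,3) show ?thesis by (auto simp: vanishing_ideal_def)
qed

text \<open>\<open>dimension\<close> is inductive, adding one line extension at a time, and h
  carries each extension to an extension. The inclusion of E in the carrier is carried along because
  h is injective only there, and injectivity keeps the image of the new vector outside the image of
  E.\<close>

lemma (in ring) dimension_ring_iso:
  assumes S: "ring S" and h: "h \<in> ring_iso R S" and K: "K \<subseteq> carrier R"
    and "dimension n K E"
  shows "E \<subseteq> carrier R \<and> ring.dimension S n (h ` K) (h ` E)"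
  using assms(4) K
proof induction
  case (zero_dim K)
  interpret S: ring S by (rule S)
  have "h \<zero> = \<zero>\<^bsub>S\<^esub>"
    using h by (auto simp: ring_iso_def intro: ring_hom_zero[OF _ ring_axioms S])
  then show ?case using S.zero_dim by simp
next
  case (Suc_dim v E n K)
  interpret S: ring S by (rule S)
  have E: "E \<subseteq> carrier R" and dim: "S.dimension n (h ` K) (h ` E)"
    using Suc_dim.IH Suc_dim.prems by auto
  have inj: "inj_on h (carrier R)" using h by (auto simp: ring_iso_def bij_betw_def)
  have "h v \<notin> h ` E"
    using inj_on_image_mem_iff[OF inj] Suc_dim.hyps E by blast
  moreover have "h v \<in> carrier S" using ring_iso_memE(1)[OF h] Suc_dim.hyps by blast
  ultimately have "S.dimension (Suc n) (h ` K) (S.line_extension (h ` K) (h v) (h ` E))"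
    using S.Suc_dim dim by blast
  moreover have "h ` line_extension K v E = S.line_extension (h ` K) (h v) (h ` E)"
  proof -
    have img: "h (k \<otimes> v \<oplus> u) = h k \<otimes>\<^bsub>S\<^esub> h v \<oplus>\<^bsub>S\<^esub> h u" if "k \<in> K" "u \<in> E" for k u
    using that Suc_dim.prems E Suc_dim.hyps ring_iso_memE(2,3)[OF h] by (metis m_closed subsetD)
    show ?thesis
    proof (rule Set.set_eqI)
      fix z
      have "z \<in> h ` line_extension K v E \<longleftrightarrow> (\<exists>k\<in>K. \<exists>u\<in>E. z = h (k \<otimes> v \<oplus> u))"
        unfolding image_iff Bex_def line_extension_mem_iff by blast
      also have "\<dots> \<longleftrightarrow> z \<in> S.line_extension (h ` K) (h v) (h ` E)"
        using img by (auto simp: S.line_extension_mem_iff)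
      finally show "z \<in> h ` line_extension K v E \<longleftrightarrow> z \<in> S.line_extension (h ` K) (h v) (h ` E)" .
    qed
  qed
  ultimately show ?case
    using line_extension_in_carrier[OF Suc_dim.prems Suc_dim.hyps(1) E] by simp
qed

text \<open>Applying the previous lemma to h and to its inverse shows that both sides satisfy
  \<open>dimension\<close> for exactly the same n. Equality of \<open>dim\<close> follows without
  knowing that such an n exists.\<close>

lemma (in ring) dim_ring_iso:
  assumes S: "ring S" and h: "h \<in> ring_iso R S"
    and K: "K \<subseteq> carrier R" and E: "E \<subseteq> carrier R"
  shows "ring.dim S (h ` K) (h ` E) = dim K E"
proof -
  interpret S: ring S by (rule S)
  let ?g = "inv_into (carrier R) h"
  have inj: "inj_on h (carrier R)" using h by (auto simp: ring_iso_def bij_betw_def)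
  have g: "?g \<in> ring_iso S R" using ring_iso_set_sym[OF ring_axioms h] .
  have "h ` K \<subseteq> carrier S" using ring_iso_memE(1)[OF h] K by blast
  then have "S.dimension n (h ` K) (h ` E) \<Longrightarrow> dimension n (?g ` h ` K) (?g ` h ` E)" for n
    using S.dimension_ring_iso[OF ring_axioms g] by blast
  moreover have "?g ` h ` K = K" "?g ` h ` E = E"
    using K E inj by (auto simp: inv_into_image_cancel)
  ultimately have "S.dimension n (h ` K) (h ` E) \<longleftrightarrow> dimension n K E" for n
    using dimension_ring_iso[OF S h K] by metis
  then show ?thesis by (simp add: dim_def S.dim_def)
qed

text \<open>The induced isomorphism of quotients is the direct image of cosets as sets, so no
  representatives have to be chosen; the second claim computes it on representatives.\<close>

lemma (in ideal) FactRing_image_ring_iso: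
  assumes S: "ring S" and h: "h \<in> ring_iso R S" and J: "ideal (h ` I) S"
  shows "(`) h \<in> ring_iso (R Quot I) (S Quot (h ` I))"
    and "a \<in> carrier R \<Longrightarrow> h ` (I +> a) = h ` I +>\<^bsub>S\<^esub> h a"
proof -
  interpret J: ideal "h ` I" S by (rule J)
  have inj: "inj_on h (carrier R)" and surj: "h ` carrier R = carrier S"
    using h by (auto simp: ring_iso_def bij_betw_def)
  have I: "I \<subseteq> carrier R" by (rule a_subset)
  have coset: "h ` (I +> a) = h ` I +>\<^bsub>S\<^esub> h a" if "a \<in> carrier R" for a
  proof -
    have "h (x \<oplus> a) = h x \<oplus>\<^bsub>S\<^esub> h a" if "x \<in> I" for x
      using ring_iso_memE(3)[OF h] that \<open>a \<in> carrier R\<close> I by blast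
    then show ?thesis by (auto simp: a_r_coset_def' image_iff)
  qed
  then show "a \<in> carrier R \<Longrightarrow> h ` (I +> a) = h ` I +>\<^bsub>S\<^esub> h a" .
  have carr: "carrier (R Quot I) = (+>) I ` carrier R"
    "carrier (S Quot (h ` I)) = (+>\<^bsub>S\<^esub>) (h ` I) ` carrier S"
    by (auto simp: FactRing_simps)
  \<comment> \<open>Cosets are subsets of the carrier, and direct image is injective on those
    because h is injective there.\<close>
  have "inj_on ((`) h) (carrier (R Quot I))"
    by (rule inj_on_subset[OF inj_on_image_Pow[OF inj]])
      (use a_r_coset_subset_G[OF I] in \<open>auto simp: carr\<close>)
  moreover have "(`) h ` carrier (R Quot I) = carrier (S Quot (h ` I))"
    unfolding carr surj[symmetric] image_image using coset by (intro image_cong) auto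
  ultimately show "(`) h \<in> ring_iso (R Quot I) (S Quot (h ` I))"
  proof (intro ring_iso_memI)
    fix A B assume "A \<in> carrier (R Quot I)" "B \<in> carrier (R Quot I)"
    then obtain a b where *: "a \<in> carrier R" "A = I +> a" "b \<in> carrier R" "B = I +> b"
      by (auto simp: carr)
    have h_closed: "h a \<in> carrier S" "h b \<in> carrier S" using * ring_iso_memE(1)[OF h] by auto
    show "h ` (A \<otimes>\<^bsub>R Quot I\<^esub> B) = h ` A \<otimes>\<^bsub>S Quot h ` I\<^esub> h ` B"
      using * h_closed ring_iso_memE(2)[OF h]
      by (simp add: FactRing_def rcoset_mult_add J.rcoset_mult_add coset)
    show "h ` (A \<oplus>\<^bsub>R Quot I\<^esub> B) = h ` A \<oplus>\<^bsub>S Quot h ` I\<^esub> h ` B"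
      using * h_closed ring_iso_memE(3)[OF h]
      by (simp add: FactRing_def a_rcos_sum J.a_rcos_sum coset)
  next
    show "h ` \<one>\<^bsub>R Quot I\<^esub> = \<one>\<^bsub>S Quot h ` I\<^esub>"
      using ring_iso_memE(4)[OF h] by (simp add: FactRing_def coset)
  qed (auto simp: bij_betw_def)
qed

lemma hilbert_function_dilate:
  fixes X :: "('k::field, 'n::finite) proj set"
  assumes t: "t \<in> torus"
  shows "hilbert_function (dilate_proj t ` X) d = hilbert_function X d"
proof -
  let ?R = "poly_ring :: ('n, 'k) mpoly ring"
  let ?tX = "dilate_proj t ` X" and ?h = "(`) (dilate_poly t)"
  interpret R: cring ?R by (rule cring_poly_ring)
  interpret I: ideal "vanishing_ideal ?tX" ?R by (rule ideal_vanishing_ideal)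
  interpret J: ideal "vanishing_ideal X" ?R by (rule ideal_vanishing_ideal)
  interpret Q: ring "coord_ring ?tX" unfolding coord_ring_def by (rule I.quotient_is_ring)
  note img = vanishing_ideal_dilate[OF t]
  \<comment> \<open>Since dilation by t carries the ideal of \<open>?tX\<close> onto that of X, the
    induced isomorphism runs from \<open>coord_ring ?tX\<close> to
    \<open>coord_ring X\<close>.\<close>
  note iso = I.FactRing_image_ring_iso[OF R.ring_axioms dilate_poly_ring_iso[OF t],
      unfolded img, OF J.ideal_axioms]
  have carr: "coord_class ?tX ` A \<subseteq> carrier (coord_ring ?tX)" for A
    using R.a_rcosetsI[OF I.a_subset]
    by (auto simp: coord_class_def coord_ring_def FactRing_def carrier_poly_ring)
  have img_class: "?h ` coord_class ?tX ` A = coord_class X ` dilate_poly t ` A" for A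
    unfolding image_image coord_class_def using iso(2)
    by (intro image_cong) (auto simp: carrier_poly_ring)
  \<comment> \<open>The monomial with exponent 0 has value 1, so dilation fixes the constants and
    the field of scalars is carried to itself.\<close>
  have img_const: "dilate_poly t ` range (\<lambda>c. term_poly c 0) = range (\<lambda>c. term_poly c 0)"
    by (simp add: image_image)
  have "ring.dim (coord_ring X) (?h ` coord_class ?tX ` range (\<lambda>c. term_poly c 0))
      (?h ` coord_class ?tX ` graded_piece d) = hilbert_function ?tX d"
    unfolding hilbert_function_def
    by (rule Q.dim_ring_iso)
      (use iso(1) carr J.quotient_is_ring in \<open>simp_all add: coord_ring_def\<close>)
  then show ?thesis
    by (simp only: img_class img_const dilate_poly_image_graded_piece[OF t] hilbert_function_def)
qed

section \<open>Hadamard products and quotients of points of binomial varieties\<close>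

lemma hadamard_point_abs:
  "x * y \<noteq> 0 \<Longrightarrow> hadamard_point (abs_proj x) (abs_proj y) = abs_proj (x * y)"
  by (subst hadamard_point.abs_eq) (auto simp: vec_eq_iff)

lemma hadamard_defined_abs:
  "x \<noteq> 0 \<Longrightarrow> y \<noteq> 0 \<Longrightarrow> hadamard_defined (abs_proj x) (abs_proj y) \<longleftrightarrow> x * y \<noteq> 0"
  by (subst hadamard_defined.abs_eq) (auto simp: vec_eq_iff)

lemma coords_prod_nonzero_cases:
  assumes "coords_prod_nonzero P"
  obtains x where "x \<in> torus" "P = abs_proj x"
proof -
  obtain x where x: "x \<noteq> 0" "P = abs_proj x" by (rule proj_cases)
  with assms have "x \<in> torus" by (simp add: coords_prod_nonzero.abs_eq torus_def)
  with x that show thesis by blast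
qed


text \<open>A closed set is the zero set of its vanishing ideal, so membership can be tested on
  generators of that ideal.\<close>

lemma projective_variety_memI:
  assumes "projective_variety X" "vanishing_ideal X = Idl\<^bsub>poly_ring\<^esub> B"
    and "\<And>f. f \<in> B \<Longrightarrow> vanishes_at f P"
  shows "P \<in> X"
proof -
  obtain S where S: "X = {P. \<forall>f\<in>S. vanishes_at f P}"
    using assms(1) unfolding projective_variety_def by blast
  then have "S \<subseteq> vanishing_ideal X" by (auto simp: vanishing_ideal_def)
  then show ?thesis using vanishes_at_genideal[OF assms(2,3)] S by blast
qed

lemma vanishes_at_genideal_generator:
  fixes X :: "('k::field, 'n::finite) proj set"
  assumes "vanishing_ideal X = Idl\<^bsub>poly_ring\<^esub> B" "f \<in> B" "P \<in> X"
  shows "vanishes_at f P"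
proof -
  interpret cring "poly_ring :: ('n, 'k) mpoly ring" by (rule cring_poly_ring)
  have "B \<subseteq> vanishing_ideal X"
    unfolding assms(1) by (rule genideal_self) (simp add: poly_ring_def)
  with assms show ?thesis by (auto simp: vanishing_ideal_def)
qed

text \<open>With w a torus point of W, the quotient v / w has equal values at both exponents of each
  generator, so multiplying u by it keeps u in V. Only w has to lie in the torus; u and v may have
  zero coordinates, and \<open>u * v \<noteq> 0\<close> ensures that the result is a point.\<close>

lemma binomial_ratio_mem:
  fixes V W :: "('k::field, 'n::finite) proj set"
  assumes V: "projective_variety V"
      "vanishing_ideal V = Idl\<^bsub>poly_ring\<^esub> ((\<lambda>i. term_poly (a i) (\<alpha> i) - term_poly (b i) (\<beta> i)) ` A)"
    and W: "vanishing_ideal W = Idl\<^bsub>poly_ring\<^esub> ((\<lambda>i. term_poly (c i) (\<alpha> i) - term_poly (d i) (\<beta> i)) ` A)"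
    and nz: "\<forall>i\<in>A. c i \<noteq> 0 \<and> d i \<noteq> 0"
    and u: "u \<noteq> 0" "abs_proj u \<in> V" and v: "v \<noteq> 0" "abs_proj v \<in> W"
    and w: "w \<in> torus" "abs_proj w \<in> W" and uv: "u * v \<noteq> 0"
  shows "abs_proj (torus_inverse w * (u * v)) \<in> V"
proof (rule projective_variety_memI[OF V])
  have w0: "w \<noteq> 0" using w(1) by (auto simp: torus_def)
  have z0: "torus_inverse w * (u * v) \<noteq> 0"
    using torus_mult_nonzero[OF torus_inverse_in[OF w(1)] uv] .
  fix f assume "f \<in> (\<lambda>i. term_poly (a i) (\<alpha> i) - term_poly (b i) (\<beta> i)) ` A"
  then obtain i where i: "i \<in> A" "f = term_poly (a i) (\<alpha> i) - term_poly (b i) (\<beta> i)" by blast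
  have W_eq: "c i * monom_eval z (\<alpha> i) = d i * monom_eval z (\<beta> i)"
    if "z \<noteq> 0" "abs_proj z \<in> W" for z
  proof -
    have "vanishes_at (term_poly (c i) (\<alpha> i) - term_poly (d i) (\<beta> i)) (abs_proj z)"
      using vanishes_at_genideal_generator[OF W] i(1) that(2) by blast
    then have "eval_poly (term_poly (c i) (\<alpha> i) - term_poly (d i) (\<beta> i)) (1 *s z) = 0"
      unfolding vanishes_at_abs[OF that(1)] using one_neq_zero by blast
    then show ?thesis by simp
  qed
  define w' where "w' = torus_inverse w"
  have inv: "monom_eval w' \<gamma> * monom_eval w \<gamma> = 1" for \<gamma>
    using w(1) by (simp add: w'_def flip: monom_eval_mult)
  have ratio: "monom_eval (w' * v) (\<alpha> i) = monom_eval (w' * v) (\<beta> i)"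
  proof -
    \<comment> \<open>The monomials of v may vanish, so the equations at v and w are not divided.
      Both sides are multiplied by \<open>c i * monom_eval w (\<alpha> i)\<close>, which is nonzero
      and is cancelled at the end.\<close>
    have "c i * monom_eval w (\<alpha> i) * monom_eval (w' * v) (\<alpha> i)
        = c i * monom_eval v (\<alpha> i) * (monom_eval w' (\<alpha> i) * monom_eval w (\<alpha> i))"
      by (simp only: monom_eval_mult ac_simps)
    also have "\<dots> = d i * monom_eval v (\<beta> i) * (monom_eval w' (\<beta> i) * monom_eval w (\<beta> i))"
      using W_eq[OF v] by (simp add: inv)
    also have "\<dots> = c i * monom_eval w (\<alpha> i) * monom_eval (w' * v) (\<beta> i)"
      using W_eq[OF w0 w(2)] by (simp add: monom_eval_mult ac_simps)
    finally show ?thesis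
      using bspec[OF nz i(1)] w(1) by (simp add: monom_eval_nonzero torus_def)
  qed
  have "eval_poly f (k *s (w' * (u * v))) = 0" if "k \<noteq> 0" for k
  proof -
    have "vanishes_at f (abs_proj u)"
      using vanishes_at_genideal_generator[OF V(2)] i u(2) by blast
    then have "eval_poly f (k *s u) = 0" using u(1) that by (simp add: vanishes_at_abs)
    \<comment> \<open>Regrouped in this way, both terms of f acquire the same factor, by
      \<open>ratio\<close>, so the value of f is that factor times its value at
      \<open>k *s u\<close>, which is 0.\<close>
    moreover have "k *s (w' * (u * v)) = (w' * v) * (k *s u)" by (simp add: vec_eq_iff)
    ultimately show ?thesis
      by (simp add: i(2) monom_eval_mult[of "w' * v"] ratio mult.left_commute[of _ "monom_eval (w' * v) _"])
  qed
  then show "vanishes_at f (abs_proj (torus_inverse w * (u * v)))"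
    using z0 by (simp add: vanishes_at_abs w'_def)
qed

theorem theorem4p12:
  fixes V W :: "('k::{alg_closed_field, field_char_0}, 'n::finite) proj set"
    and p q :: "('k, 'n) proj"
  assumes "binomial_variety V" and "binomial_variety W"
    and "same_binomial_exponents V W"
    and "p \<in> V" and "coords_prod_nonzero p"
    and "q \<in> W" and "coords_prod_nonzero q"
  shows "(\<forall>i. hilbert_function V i = hilbert_function W i \<and>
              hilbert_function W i = hilbert_function (V \<star> W) i) \<and>
         (variety_degree V = variety_degree W \<and> variety_degree W = variety_degree (V \<star> W)) \<and>
         (variety_dim V = variety_dim W \<and> variety_dim W = variety_dim (V \<star> W))"
proof -
  have var: "projective_variety V" "projective_variety W"
    using assms(1,2) by (auto simp: binomial_variety_def)
  obtain x where x: "x \<in> torus" "p = abs_proj x"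
    using coords_prod_nonzero_cases[OF assms(5)] by blast
  obtain y where y: "y \<in> torus" "q = abs_proj y"
    using coords_prod_nonzero_cases[OF assms(7)] by blast
  have xV: "x \<noteq> 0" "abs_proj x \<in> V" and yW: "y \<noteq> 0" "abs_proj y \<in> W"
    using x y assms(4,6) by (auto simp: torus_def)
  obtain s :: nat and \<alpha> \<beta> a b c d where
    coeffs: "\<forall>i<s. a i \<noteq> 0 \<and> b i \<noteq> 0 \<and> c i \<noteq> 0 \<and> d i \<noteq> 0" and
    V: "vanishing_ideal V = Idl\<^bsub>poly_ring\<^esub> ((\<lambda>i. term_poly (a i) (\<alpha> i) - term_poly (b i) (\<beta> i)) ` {..<s})" and
    W: "vanishing_ideal W = Idl\<^bsub>poly_ring\<^esub> ((\<lambda>i. term_poly (c i) (\<alpha> i) - term_poly (d i) (\<beta> i)) ` {..<s})"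
    using assms(3) unfolding same_binomial_exponents_def
    by (elim exE conjE) (rule that, assumption+)
  have nz: "\<forall>i\<in>{..<s}. a i \<noteq> 0 \<and> b i \<noteq> 0" "\<forall>i\<in>{..<s}. c i \<noteq> 0 \<and> d i \<noteq> 0"
    using coeffs by auto
  \<comment> \<open>The exponents are shared, so the lemma also applies with V and W exchanged:
    \<open>mem_V\<close> multiplies points of V by quotients from W, and \<open>mem_W\<close> does
    the reverse.\<close>
  note mem_V = binomial_ratio_mem[OF var(1) V W nz(2)]
  note mem_W = binomial_ratio_mem[OF var(2) W V nz(1)]

  have V_eq: "V = dilate_proj (torus_inverse y * x) ` W"
  proof (intro subset_antisym subsetI)
    fix P assume "P \<in> V"
    obtain u where u: "u \<noteq> 0" "P = abs_proj u" by (rule proj_cases)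
    have yu: "y * u \<noteq> 0" using y(1) u(1) by (rule torus_mult_nonzero)
    \<comment> \<open>The preimage of u under dilation by x / y is y u / x, that is, y in W
      multiplied by the quotient u / x from V.\<close>
    have "abs_proj (torus_inverse x * (y * u)) \<in> W"
      using mem_W[OF yW u(1) _ x(1) xV(2) yu] \<open>P \<in> V\<close> u(2) by blast
    moreover have "P = dilate_proj (torus_inverse y * x) (abs_proj (torus_inverse x * (y * u)))"
    proof -
      have "torus_inverse y * x * (torus_inverse x * (y * u)) = u"
        using x(1) y(1) by (simp add: torus_def torus_inverse_def vec_eq_iff field_simps)
      then show ?thesis
        using x(1) y(1) yu u by (simp add: dilate_proj_abs torus_mult_nonzero)
    qed
    ultimately show "P \<in> dilate_proj (torus_inverse y * x) ` W" by blast
  next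
    fix P assume "P \<in> dilate_proj (torus_inverse y * x) ` W"
    then obtain Q where Q: "Q \<in> W" "P = dilate_proj (torus_inverse y * x) Q" by blast
    obtain v where v: "v \<noteq> 0" "Q = abs_proj v" by (rule proj_cases)
    \<comment> \<open>Conversely x v / y is x in V multiplied by the quotient v / y from W.\<close>
    have "x * v \<noteq> 0" using x(1) v(1) by (rule torus_mult_nonzero)
    then have "abs_proj (torus_inverse y * (x * v)) \<in> V"
      using mem_V[OF xV v(1) _ y(1) yW(2)] Q(1) v(2) by blast
    then show "P \<in> V" using Q v x(1) y(1) by (simp add: dilate_proj_abs mult.assoc)
  qed

  have "{hadamard_point P Q | P Q. P \<in> V \<and> Q \<in> W \<and> hadamard_defined P Q} = dilate_proj y ` V"
    (is "?A = _")
  proof (intro subset_antisym subsetI)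
    fix P assume "P \<in> ?A"
    then obtain Q Q' where Q: "P = hadamard_point Q Q'" "Q \<in> V" "Q' \<in> W" "hadamard_defined Q Q'"
      by blast
    obtain u where u: "u \<noteq> 0" "Q = abs_proj u" by (rule proj_cases)
    obtain v where v: "v \<noteq> 0" "Q' = abs_proj v" by (rule proj_cases)
    have uv: "u * v \<noteq> 0" using Q(4) u v by (simp add: hadamard_defined_abs)
    \<comment> \<open>Writing u v as y times u v / y exhibits every defined product as the dilation
      by y of a point of V.\<close>
    have "abs_proj (torus_inverse y * (u * v)) \<in> V"
      using mem_V[OF u(1) _ v(1) _ y(1) yW(2) uv] Q(2,3) u(2) v(2) by blast
    moreover have "y * (torus_inverse y * (u * v)) = u * v"
      using y(1) by (metis mult.assoc mult_1 torus_inverse_right)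
    then have "P = dilate_proj y (abs_proj (torus_inverse y * (u * v)))"
      using y(1) uv u v
      by (simp add: Q(1) hadamard_point_abs dilate_proj_abs torus_mult_nonzero)
    ultimately show "P \<in> dilate_proj y ` V" by blast
  next
    fix P assume "P \<in> dilate_proj y ` V"
    then obtain Q where Q: "Q \<in> V" "P = dilate_proj y Q" by blast
    obtain u where u: "u \<noteq> 0" "Q = abs_proj u" by (rule proj_cases)
    \<comment> \<open>Dilating by y is multiplying by the point q of W, and this product is always
      defined since q has no zero coordinate.\<close>
    have "u * y \<noteq> 0" using torus_mult_nonzero[OF y(1) u(1)] by (simp add: mult.commute)
    then have "P = hadamard_point Q q" "hadamard_defined Q q"
      using Q(2) u y yW(1)
      by (simp_all add: dilate_proj_abs hadamard_point_abs hadamard_defined_abs mult.commute)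
    with Q(1) assms(6) show "P \<in> ?A" by blast
  qed
  then have VW_eq: "V \<star> W = dilate_proj y ` V"
    using projective_variety_dilate[OF y(1) var(1)]
    by (simp add: hadamard_product_def hull_same)

  have "hilbert_function V = hilbert_function W"
    using V_eq hilbert_function_dilate[of "torus_inverse y * x" W] x(1) y(1)
    by (metis ext torus_inverse_in torus_mult)
  moreover have "hilbert_function (V \<star> W) = hilbert_function V"
    using hilbert_function_dilate[OF y(1)] by (simp add: VW_eq fun_eq_iff)
  \<comment> \<open>Degree and dimension are defined from the Hilbert function alone, so equality of
    functions suffices; existence of the Hilbert polynomial is not invoked.\<close>
  ultimately show ?thesis
    by (simp add: variety_degree_def variety_dim_def hilbert_polynomial_def)
qed

end
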